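(* For all $m \in \mathbb{N}$, $s \in (m-1,m)$, $u \in \ell^2(\mathbb{Z})$, $n \in \mathbb{Z}$ it holds that $$\big((-\Delta)^s u\big)(n) = \sum_{k\in\mathbb{Z}} K_s(n-k)\,\big(u(n)-u(k)\big).$$
   Context: $\mathbb{N} = \{1,2,3,\ldots\}$, $\mathbb{N}_0=\mathbb{N}\cup\{0\}$. $\ell^2(\mathbb{Z})$ is the set of all $u \colon \mathbb{Z} \to \mathbb{R}$ with $\sum_{k\in\mathbb{Z}} |u(k)|^2 < \infty$. $\Gamma$ is the Gamma function (meromorphically continued), with the convention $1/\Gamma(w) = 0$ for $w \in \{\ldots,-2,-1,0\}$. The discrete fractional kernel: for $s \in (0,\infty)\setminus\mathbb{N}$ the function $K_s \colon \mathbb{Z}\to\mathbb{R}$ is given by $K_s(0)=0$ and, for $k \ne 0$, $$K_s(k) = \frac{-4^s\,\Gamma(\tfrac12+s)\,\Gamma(|k|-s)}{\sqrt{\pi}\,\Gamma(-s)\,\Gamma(|k|+1+s)}.$$ The discrete Laplace operator $\Delta \colon \ell^2(\mathbb{Z}) \to \ell^2(\mathbb{Z})$ is $(\Delta u)(n) = u(n-1) - 2u(n) + u(n+1)$. Integer powers are defined by iteration: $(-\Delta)^0 u = u$ and $(-\Delta)^k u = -\Delta\big((-\Delta)^{k-1}u\big)$ for $k\in\mathbb{N}$. The discrete heat semigroup $S_z(\Delta) \colon \ell^2(\mathbb{Z}) \to \ell^2(\mathbb{Z})$, $z \in [0,\infty)$, is $$(S_z(\Delta)u)(n) = \sum_{k\in\mathbb{Z}}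 \exp(-2z)\left[\sum_{j\in\mathbb{N}_0} \frac{z^{2j+n-k}}{\Gamma(1+j)\,\Gamma(j+n-k+1)}\right] u(k),$$ where terms with $j+n-k+1 \le 0$ are zero by the convention on $1/\Gamma$, and $0^0=1$. $\mathbb{I}$ is the identity operator. For $s \in (0,\infty)\setminus\mathbb{N}$, the discrete fractional Laplace operator $(-\Delta)^s \colon \ell^2(\mathbb{Z}) \to \ell^2(\mathbb{Z})$ is defined, with $\lfloor s\rfloor$ the integer part of $s$, by $$\big((-\Delta)^s u\big)(n) = \frac{1}{\Gamma(-(s-\lfloor s\rfloor))}\int_0^\infty z^{-(s-\lfloor s\rfloor)-1}\,\Big([S_z(\Delta)-\mathbb{I}]\,(-\Delta)^{\lfloor s\rfloor}u\Big)(n)\,dz .$$ *)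

theory Defs
  imports "HOL-Analysis.Analysis"
begin

text \<open>Sequences are total functions \<open>int \<Rightarrow> real\<close>; the operators below are given by their formulas on
  all such functions and are meaningful on \<open>ell2\<close>.\<close>

definition ell2 :: "(int \<Rightarrow> real) set" where
  "ell2 = {u. (\<lambda>k. \<bar>u k\<bar>\<^sup>2) summable_on UNIV}"

definition frac_kernel :: "real \<Rightarrow> int \<Rightarrow> real" where
  "frac_kernel s k =
     (if k = 0 then 0
      else (- (4 powr s) * Gamma (1/2 + s) * Gamma (of_int \<bar>k\<bar> - s)) /
           (sqrt pi * Gamma (- s) * Gamma (of_int \<bar>k\<bar> + 1 + s)))"

definition discrete_laplace :: "(int \<Rightarrow> real) \<Rightarrow> int \<Rightarrow> real" where
  "discrete_laplace u n = u (n - 1) - 2 * u n + u (n + 1)"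

definition neg_laplace_power :: "nat \<Rightarrow> (int \<Rightarrow> real) \<Rightarrow> int \<Rightarrow> real" where
  "neg_laplace_power k = (\<lambda>v n. - discrete_laplace v n) ^^ k"

text \<open>\<open>rGamma\<close> is the entire function \<open>1 / Gamma\<close>, which vanishes at the nonpositive integers. The
  exponent \<open>2 * j + n - k\<close> can be negative only where the factor \<open>rGamma (j + n - k + 1)\<close> is zero.\<close>

definition heat_semigroup :: "real \<Rightarrow> (int \<Rightarrow> real) \<Rightarrow> int \<Rightarrow> real" where
  "heat_semigroup z u n =
     (\<Sum>\<^sub>\<infinity>k\<in>UNIV. exp (- 2 * z) *
        (\<Sum>j. z powi (2 * int j + n - k) * (rGamma (1 + real j) * rGamma (of_int (int j + n - k + 1)))) *
        u k)"

definition frac_laplace :: "real \<Rightarrow> (int \<Rightarrow> real) \<Rightarrow> int \<Rightarrow> real" where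
  "frac_laplace s u n =
     1 / Gamma (- (s - of_int \<lfloor>s\<rfloor>)) *
     (LBINT z:{0<..}. z powr (- (s - of_int \<lfloor>s\<rfloor>) - 1) *
        (heat_semigroup z (neg_laplace_power (nat \<lfloor>s\<rfloor>) u) n - neg_laplace_power (nat \<lfloor>s\<rfloor>) u n))"

end

theory Submission
  imports Defs
begin

text \<open>
  Formally \<open>(-\<Delta>)\<^sup>s\<close> is the Fourier multiplier \<open>(2 - 2 cos \<theta>)\<^sup>s\<close>, so it ought to be the convolution
  with the Fourier coefficients of that function,
  \<open>a\<^sub>s(k) = 4\<^sup>s \<Gamma>(1/2 + s) \<Gamma>(|k| - s) / (\<surd>\<pi> \<Gamma>(-s) \<Gamma>(|k| + 1 + s))\<close>.
  Away from the origin \<open>a\<^sub>s\<close> is \<open>-K\<^sub>s\<close>. As the multiplier vanishes at \<open>\<theta> = 0\<close>, the coefficients sum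
  to \<open>0\<close>, and therefore \<open>(a\<^sub>s * u)(n) = \<Sum>\<^sub>k K\<^sub>s(n - k) (u(n) - u(k))\<close>: the claim is that
  \<open>(-\<Delta>)\<^sup>s u = a\<^sub>s * u\<close>. The argument establishes this without Fourier analysis. Sequences in \<open>\<ell>\<^sup>2\<close>
  are bounded and \<open>a\<^sub>s\<close> is absolutely summable, so all convolutions converge absolutely.

  Fractional part. Let \<open>0 < \<alpha> < 1\<close> and let \<open>G\<^sub>z\<close> be the heat kernel
  \<open>e\<^sup>-\<^sup>2\<^sup>z I\<^sub>k(2z)\<close>. It is even, nonnegative and of mass \<open>1\<close> (\<open>bessel_kernel_has_sum\<close>; it is the
  law of the difference of two independent Poisson variables), so \<open>S\<^sub>z v - v\<close> is
  \<open>\<Sum>\<^sub>k G\<^sub>z(n - k) (v(k) - v(n))\<close>. Integrating against \<open>z\<^sup>-\<^sup>\<alpha>\<^sup>-\<^sup>1\<close> term by term reduces the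
  problem to the Mellin transform of \<open>G\<^sub>z(k)\<close> for \<open>k \<noteq> 0\<close>. Expanding \<open>I\<^sub>k\<close> in its power series
  turns that integral into a series of Gamma quotients, which is a hypergeometric series
  at \<open>1\<close>; Gauss's theorem sums it to \<open>\<Gamma>(-\<alpha>) a\<^sub>\<alpha>(k)\<close> (\<open>bessel_kernel_mellin\<close>). Every term in this
  computation is nonnegative, so its exchanges of sum and integral are monotone convergence.

  Integer part. The recursion \<open>(k + 1 + s) a\<^sub>s(k + 1) = (k - s) a\<^sub>s(k)\<close> makes
  \<open>(k - s) a\<^sub>s(k)\<close> telescope, which yields absolute summability and the sum \<open>0\<close>
  (\<open>frac_coeff_sums\<close>). The Gamma recursion shows that minus the second difference
  of \<open>a\<^sub>s\<close> is \<open>a\<^sub>s\<^sub>+\<^sub>1\<close> (\<open>frac_symbol_add1\<close>), and summation by parts then gives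
  \<open>a\<^sub>\<alpha> * (-\<Delta>)\<^sup>p u = a\<^sub>\<alpha>\<^sub>+\<^sub>p * u\<close> (\<open>frac_conv_neg_laplace_power\<close>).
\<close>

section \<open>Gamma function and summation preliminaries\<close>

lemma not_nonpos_Ints_if_pos: "(x::real) > 0 \<Longrightarrow> x \<notin> \<int>\<^sub>\<le>\<^sub>0"
  by (auto elim!: nonpos_Ints_cases)

lemma has_sum_diff:
  fixes f g :: "'a \<Rightarrow> real"
  assumes "(f has_sum a) A" "(g has_sum b) A"
  shows "((\<lambda>x. f x - g x) has_sum (a - b)) A"
  using has_sum_add[OF assms(1), of "\<lambda>x. - g x" "- b"] assms(2) by (simp add: has_sum_uminus)

lemma nat_diff_not_Ints: "(s::real) \<notin> \<int> \<Longrightarrow> real k - s \<notin> \<int>"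
  using Ints_diff[of "real k" "real k - s"] by auto

lemma not_Ints_add1: "(s::real) \<notin> \<int> \<Longrightarrow> s + 1 \<notin> \<int>"
  using Ints_diff[of "s + 1" 1] by auto

lemma Gamma_uminus_neq_0: "(s::real) \<notin> \<int> \<Longrightarrow> Gamma (- s) \<noteq> 0"
  using minus_in_Ints_iff[of s] by (auto simp: Gamma_eq_zero_iff)

lemma nn_integral_ennreal_cmult:
  fixes f :: "'a \<Rightarrow> real"
  assumes "c \<ge> 0" and [measurable]: "f \<in> borel_measurable M"
  shows "(\<integral>\<^sup>+x. ennreal (c * f x) \<partial>M) = ennreal c * (\<integral>\<^sup>+x. ennreal (f x) \<partial>M)"
  using assms(1) by (subst nn_integral_cmult[symmetric]) (auto simp: ennreal_mult')

lemma has_sum_imp_abs_summable_real: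
  fixes f :: "'a \<Rightarrow> real"
  assumes "(f has_sum a) A"
  shows "(\<lambda>x. \<bar>f x\<bar>) summable_on A"
  using has_sum_imp_summable[OF assms] summable_on_iff_abs_summable_on_real[of f A] by simp

lemma bij_int_reflect: "bij_betw (\<lambda>k. n - k) UNIV (UNIV :: int set)"
  by (rule bij_betw_byWitness[where f' = "\<lambda>k. n - k"]) auto

lemma bij_int_translate: "bij_betw (\<lambda>k. k + c) UNIV (UNIV :: int set)"
  by (rule bij_betw_byWitness[where f' = "\<lambda>k. k - c"]) auto

lemma has_sum_int_even:
  fixes f :: "nat \<Rightarrow> real"
  assumes f0: "((\<lambda>k. f (Suc k)) has_sum S) UNIV"
  shows "((\<lambda>k::int. f (nat \<bar>k\<bar>)) has_sum f 0 + 2 * S) UNIV"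
proof -
  have pos: "((\<lambda>k::int. f (nat \<bar>k\<bar>)) has_sum S) (range (\<lambda>n. int (Suc n)))"
    using f0 by (subst has_sum_reindex) (auto simp: inj_on_def o_def nat_add_distrib)
  have neg: "((\<lambda>k::int. f (nat \<bar>k\<bar>)) has_sum S) (range (\<lambda>n. - int (Suc n)))"
    using f0 by (subst has_sum_reindex) (auto simp: inj_on_def o_def nat_add_distrib)
  have zero: "((\<lambda>k::int. f (nat \<bar>k\<bar>)) has_sum f 0) {0}"
    using has_sum_finite[of "{0::int}" "\<lambda>k. f (nat \<bar>k\<bar>)"] by simp
  have "((\<lambda>k::int. f (nat \<bar>k\<bar>)) has_sum (f 0 + (S + S))) ({0} \<union> (range (\<lambda>n. int (Suc n)) \<union> range (\<lambda>n. - int (Suc n))))"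
    by (intro has_sum_Un_disjoint pos neg zero) auto
  also have "{0} \<union> (range (\<lambda>n. int (Suc n)) \<union> range (\<lambda>n. - int (Suc n))) = UNIV"
  proof -
    have "k \<in> {0} \<union> (range (\<lambda>n. int (Suc n)) \<union> range (\<lambda>n. - int (Suc n)))" for k :: int
    proof (cases k rule: linorder_cases[of _ 0])
      case less
      hence "k = - int (Suc (nat (- k - 1)))" by simp
      thus ?thesis by blast
    next
      case greater
      hence "k = int (Suc (nat (k - 1)))" by simp
      thus ?thesis by blast
    qed auto
    thus ?thesis by blast
  qed
  finally show ?thesis by simp
qed

text \<open>Comparison with the harmonic series. It identifies the limit of \<open>k f(k)\<close> as \<open>0\<close> once \<open>f\<close> is known
  to be absolutely summable and the limit is known to exist.\<close>

lemma not_summable_if_mult_index_tendsto_nonzero: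
  fixes f :: "nat \<Rightarrow> real"
  assumes "(\<lambda>k. real k * f k) \<longlonglongrightarrow> L" "L \<noteq> 0"
  shows "\<not> summable (\<lambda>k. \<bar>f k\<bar>)"
proof
  assume summ: "summable (\<lambda>k. \<bar>f k\<bar>)"
  have "(\<lambda>k. \<bar>real k * f k\<bar>) \<longlonglongrightarrow> \<bar>L\<bar>" by (intro tendsto_rabs assms)
  hence "eventually (\<lambda>k. \<bar>real k * f k\<bar> > \<bar>L\<bar> / 2) sequentially"
    by (rule order_tendstoD) (use assms in auto)
  hence "eventually (\<lambda>k. norm (inverse (real k)) \<le> \<bar>f k\<bar> * (2 / \<bar>L\<bar>)) sequentially"
    using eventually_gt_at_top[of 0]
    by eventually_elim (use assms in \<open>auto simp: field_simps abs_mult\<close>)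
  hence "summable (\<lambda>k. inverse (real k))"
    by (rule summable_comparison_test_ev) (intro summable_mult2 summ)
  thus False using not_summable_harmonic[where 'a = real] by simp
qed

section \<open>Gauss's hypergeometric sum\<close>

text \<open>Gauss's theorem for \<open>\<^sub>2F\<^sub>1(a, b; c; 1)\<close>, in the range where all terms are positive. The quotient
  \<open>\<Gamma>(j + b) / \<Gamma>(j + c)\<close> is a multiple of the Beta integral of \<open>t\<^sup>j\<^sup>+\<^sup>b\<^sup>-\<^sup>1 (1 - t)\<^sup>c\<^sup>-\<^sup>b\<^sup>-\<^sup>1\<close>. Summing
  under the integral, the remaining factors form the binomial series of \<open>(1 - t)\<^sup>-\<^sup>a\<close>, and what is
  left is another Beta integral.\<close>

lemma Gauss_hypergeometric_sum:
  fixes a b c :: real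
  assumes a: "a > 0" and b: "b > 0" and c: "c > a + b"
  shows "(\<lambda>j. Gamma (real j + a) * Gamma (real j + b) / (fact j * Gamma (real j + c))) sums
           (Gamma a * Gamma b * Gamma (c - a - b) / (Gamma (c - a) * Gamma (c - b)))"
proof -
  define I :: "real set" where "I = {0<..<1}"
  define C where "C = Gamma a / Gamma (c - b)"
  define F where "F = (\<lambda>(j::nat) t. C * (pochhammer a j / fact j) *
                        (indicator I t * (t powr (real j + b - 1) * (1 - t) powr (c - b - 1))))"
  have [measurable]: "I \<in> sets borel" by (simp add: I_def)
  have Gpos: "Gamma x > 0" if "x > 0" for x :: real using that by (rule Gamma_real_pos)
  have C: "C > 0" unfolding C_def using a b c by (intro divide_pos_pos Gpos) auto
  have poch: "pochhammer a j = Gamma (real j + a) / Gamma a" for j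
    using pochhammer_Gamma[of a j] a by (simp add: add.commute not_nonpos_Ints_if_pos)
  have poch_pos: "pochhammer a j / fact j > 0" for j
    using a by (intro divide_pos_pos pochhammer_pos) auto
  have Beta_int: "(\<integral>\<^sup>+t. ennreal (indicator I t * (t powr (p - 1) * (1 - t) powr (q - 1))) \<partial>lborel)
                    = ennreal (Beta p q)" if "p > 0" "q > 0" for p q :: real
    unfolding I_def
    by (rule nn_integral_has_integral_lebesgue)
       (use has_integral_Beta_real[OF that] in \<open>auto simp: has_integral_Icc_iff_Ioo\<close>)
  have F_nonneg: "F j t \<ge> 0" for j t
    unfolding F_def using C poch_pos[of j] by (intro mult_nonneg_nonneg) auto
  have F_int: "(\<integral>\<^sup>+t. ennreal (F j t) \<partial>lborel)
        = ennreal (Gamma (real j + a) * Gamma (real j + b) / (fact j * Gamma (real j + c)))" for j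
  proof -
    have "(\<integral>\<^sup>+t. ennreal (F j t) \<partial>lborel) = ennreal (C * (pochhammer a j / fact j)) *
            (\<integral>\<^sup>+t. ennreal (indicator I t * (t powr (real j + b - 1) * (1 - t) powr (c - b - 1))) \<partial>lborel)"
      unfolding F_def
      using C poch_pos[of j] by (intro nn_integral_ennreal_cmult mult_nonneg_nonneg less_imp_le) auto
    also have "\<dots> = ennreal (C * (pochhammer a j / fact j) * Beta (real j + b) (c - b))"
      using C poch_pos[of j] a b c
      by (subst Beta_int, simp, simp) (intro ennreal_mult'[symmetric] mult_nonneg_nonneg less_imp_le)
    also have "C * (pochhammer a j / fact j) * Beta (real j + b) (c - b)
                = Gamma (real j + a) * Gamma (real j + b) / (fact j * Gamma (real j + c))"
      using less_imp_neq[OF Gpos[OF a]] less_imp_neq[OF Gpos[of "c - b"]] a c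
      unfolding C_def poch Beta_def by (simp add: field_simps)
    finally show ?thesis .
  qed
  have F_sum: "(\<Sum>j. ennreal (F j t)) =
      ennreal (C * (indicator I t * (t powr (b - 1) * (1 - t) powr ((c - a - b) - 1))))" for t
  proof (cases "t \<in> I")
    case True
    hence t: "0 < t" "t < 1" by (auto simp: I_def)
    have "(\<lambda>j. (- a gchoose j) * (- t) ^ j) sums (1 + - t) powr (- a)"
      using t by (intro gen_binomial_real) auto
    also have "(\<lambda>j. (- a gchoose j) * (- t) ^ j) = (\<lambda>j. pochhammer a j / fact j * t ^ j)"
    proof
      fix j
      have "(- 1) ^ j * (- t) ^ j = t ^ j" by (subst power_mult_distrib[symmetric]) simp
      thus "(- a gchoose j) * (- t) ^ j = pochhammer a j / fact j * t ^ j"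
        by (simp add: gbinomial_pochhammer algebra_simps)
    qed
    finally have "(\<lambda>j. (C * (t powr (b - 1) * (1 - t) powr (c - b - 1))) * (pochhammer a j / fact j * t ^ j))
             sums ((C * (t powr (b - 1) * (1 - t) powr (c - b - 1))) * (1 - t) powr (- a))"
      by (intro sums_mult) simp
    also have "(\<lambda>j. (C * (t powr (b - 1) * (1 - t) powr (c - b - 1))) * (pochhammer a j / fact j * t ^ j))
                 = (\<lambda>j. F j t)"
    proof
      fix j
      have "t powr (real j + b - 1) = t ^ j * t powr (b - 1)"
        using t powr_add[of t "real j" "b - 1"] by (simp add: powr_realpow add_diff_eq)
      thus "(C * (t powr (b - 1) * (1 - t) powr (c - b - 1))) * (pochhammer a j / fact j * t ^ j) = F j t"
        using True by (simp add: F_def)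
    qed
    also have "(C * (t powr (b - 1) * (1 - t) powr (c - b - 1))) * (1 - t) powr (- a)
              = C * (indicator I t * (t powr (b - 1) * (1 - t) powr ((c - a - b) - 1)))"
    proof -
      have "(1 - t) powr ((c - a - b) - 1) = (1 - t) powr (c - b - 1) * (1 - t) powr (- a)"
        by (simp add: powr_add[symmetric] algebra_simps)
      thus ?thesis using True by simp
    qed
    finally show ?thesis using F_nonneg by (intro suminf_ennreal_eq) auto
  qed (simp add: F_def)
  have "(\<Sum>j. ennreal (Gamma (real j + a) * Gamma (real j + b) / (fact j * Gamma (real j + c))))
          = (\<Sum>j. \<integral>\<^sup>+t. ennreal (F j t) \<partial>lborel)" by (simp add: F_int)
  also have "\<dots> = (\<integral>\<^sup>+t. (\<Sum>j. ennreal (F j t)) \<partial>lborel)"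
    by (rule nn_integral_suminf[symmetric]) (auto simp: F_def)
  also have "\<dots> = ennreal C * (\<integral>\<^sup>+t. ennreal (indicator I t * (t powr (b - 1) * (1 - t) powr ((c - a - b) - 1))) \<partial>lborel)"
    unfolding F_sum using C by (intro nn_integral_ennreal_cmult) auto
  also have "\<dots> = ennreal (C * Beta b (c - a - b))"
    using Beta_int[of b "c - a - b"] b c C by (subst ennreal_mult') auto
  also have "C * Beta b (c - a - b) = Gamma a * Gamma b * Gamma (c - a - b) / (Gamma (c - a) * Gamma (c - b))"
    unfolding C_def Beta_def by (simp add: field_simps)
  finally have "(\<Sum>j. ennreal (Gamma (real j + a) * Gamma (real j + b) / (fact j * Gamma (real j + c))))
      = ennreal (Gamma a * Gamma b * Gamma (c - a - b) / (Gamma (c - a) * Gamma (c - b)))" .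
  hence "(\<lambda>j. ennreal (Gamma (real j + a) * Gamma (real j + b) / (fact j * Gamma (real j + c)))) sums
      ennreal (Gamma a * Gamma b * Gamma (c - a - b) / (Gamma (c - a) * Gamma (c - b)))"
    unfolding sums_iff by (intro conjI summableI)
  thus ?thesis
    by (subst (asm) sums_ennreal) (use a b c in \<open>simp_all add: Gpos less_imp_le\<close>)
qed

lemma Gamma_legendre_duplication_real:
  fixes x :: real
  assumes "x > 0"
  shows "Gamma x * Gamma (x + 1/2) = 2 powr (1 - 2 * x) * sqrt pi * Gamma (2 * x)"
proof -
  have "complex_of_real y \<notin> \<int>\<^sub>\<le>\<^sub>0" if "y > 0" for y
    using not_nonpos_Ints_if_pos[OF that] by (simp add: of_real_in_nonpos_Ints_iff)
  from this[OF assms] this[of "x + 1/2"] assms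
  have "Gamma (complex_of_real x) * Gamma (complex_of_real x + 1/2) =
          exp ((1 - 2 * complex_of_real x) * of_real (ln 2)) * of_real (sqrt pi) * Gamma (2 * complex_of_real x)"
    by (intro Gamma_legendre_duplication) auto
  also have "complex_of_real x + 1/2 = of_real (x + 1/2)" by simp
  also have "2 * complex_of_real x = of_real (2 * x)" by simp
  also have "exp ((1 - complex_of_real (2 * x)) * of_real (ln 2)) = of_real (exp ((1 - 2 * x) * ln 2))"
    by (simp add: exp_of_real[symmetric])
  finally have "complex_of_real (Gamma x * Gamma (x + 1/2)) =
     of_real (exp ((1 - 2 * x) * ln 2) * sqrt pi * Gamma (2 * x))"
    unfolding Gamma_complex_of_real of_real_mult[symmetric] .
  thus ?thesis by (simp only: of_real_eq_iff) (simp add: powr_def)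
qed

section \<open>The discrete heat kernel and its mass\<close>

text \<open>This is \<open>e\<^sup>-\<^sup>2\<^sup>z I\<^sub>k(2z)\<close> with \<open>I\<^sub>k\<close> the modified Bessel function of order \<open>k\<close>. The order is a natural
  number because \<open>I\<^sub>-\<^sub>k = I\<^sub>k\<close>.\<close>

definition bessel_kernel :: "real \<Rightarrow> nat \<Rightarrow> real" where
  "bessel_kernel z k = exp (- 2 * z) * (\<Sum>j. z ^ (2 * j + k) / (fact j * fact (j + k)))"

lemma summable_bessel: "summable (\<lambda>j. (z::real) ^ (2 * j + k) / (fact j * fact (j + k)))"
proof (rule summable_norm_cancel, rule summable_comparison_test')
  show "summable (\<lambda>j. \<bar>z\<bar> ^ k * ((z\<^sup>2) ^ j / fact j))"
    using summable_exp[of "z\<^sup>2"] by (intro summable_mult) (simp add: field_simps)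
  fix j :: nat
  have "\<bar>z\<bar> ^ (2 * j + k) / (fact j * fact (j + k)) \<le> \<bar>z\<bar> ^ (2 * j + k) / (fact j * 1)"
    by (intro divide_left_mono mult_left_mono mult_pos_pos) auto
  thus "norm (norm (z ^ (2 * j + k) / (fact j * fact (j + k)))) \<le> \<bar>z\<bar> ^ k * ((z\<^sup>2) ^ j / fact j)"
    by (simp add: abs_mult power_abs power_add mult.commute[of _ "\<bar>z\<bar> ^ k"] power_mult)
qed

lemma bessel_kernel_nonneg: "z \<ge> 0 \<Longrightarrow> bessel_kernel z k \<ge> 0"
  unfolding bessel_kernel_def by (intro mult_nonneg_nonneg suminf_nonneg summable_bessel) auto

lemma measurable_bessel_kernel [measurable]: "(\<lambda>z. bessel_kernel z k) \<in> borel_measurable borel"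
  unfolding bessel_kernel_def by measurable

text \<open>The difference of two independent Poisson variables of parameter \<open>z\<close> has law \<open>G\<^sub>z\<close>: the product
  of two exponential series is regrouped along the diagonals \<open>i - j = d\<close> of \<open>\<nat> \<times> \<nat>\<close>.\<close>

lemma bessel_kernel_has_sum:
  assumes z: "z \<ge> (0::real)"
  shows "((\<lambda>d::int. bessel_kernel z (nat \<bar>d\<bar>)) has_sum 1) UNIV"
proof -
  define h where "h = (\<lambda>(i::nat, j::nat). (z ^ i / fact i) * (z ^ j / fact j))"
  \<comment> \<open>\<open>\<phi> (d, j)\<close> is the pair with difference \<open>d\<close> and minimum \<open>j\<close>.\<close>
  define \<phi> where "\<phi> = (\<lambda>(d::int, j::nat). (j + nat d, j + nat (- d)))"
  have exp_sum: "((\<lambda>i. z ^ i / fact i) has_sum exp z) UNIV"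
    using exp_converges[of z] z by (intro sums_nonneg_imp_has_sum) (auto simp: field_simps)
  have row: "((\<lambda>j. h (i, j)) has_sum (z ^ i / fact i) * exp z) UNIV" for i
    using has_sum_cmult_right[OF exp_sum, of "z ^ i / fact i"] by (simp add: h_def)
  have "(h has_sum exp z * exp z) (UNIV \<times> UNIV)"
  proof (rule has_sum_SigmaI)
    show "((\<lambda>j. h (i, j)) has_sum (z ^ i / fact i) * exp z) UNIV" for i by (rule row)
    show "((\<lambda>i. (z ^ i / fact i) * exp z) has_sum exp z * exp z) UNIV"
      by (intro has_sum_cmult_left exp_sum)
    show "h summable_on UNIV \<times> UNIV"
    proof (rule summable_on_SigmaI)
      show "((\<lambda>j. h (i, j)) has_sum (z ^ i / fact i) * exp z) UNIV" for i by (rule row)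
      show "(\<lambda>i. (z ^ i / fact i) * exp z) summable_on UNIV"
        using has_sum_cmult_left[OF exp_sum] by (rule has_sum_imp_summable)
    qed (use z in \<open>auto simp: h_def\<close>)
  qed
  moreover have "bij_betw \<phi> (UNIV \<times> UNIV) (UNIV \<times> UNIV)"
    by (rule bij_betw_byWitness[where f' = "\<lambda>(i, j). (int i - int j, min i j)"])
       (auto simp: \<phi>_def min_def)
  ultimately have "((\<lambda>x. h (\<phi> x)) has_sum exp z * exp z) (UNIV \<times> UNIV)"
    by (subst has_sum_reindex_bij_betw)
  hence "((\<lambda>d::int. exp (2 * z) * bessel_kernel z (nat \<bar>d\<bar>)) has_sum exp z * exp z) UNIV"
  proof (rule has_sum_SigmaD)
    fix d :: int
    have "(\<lambda>j. z ^ (2 * j + nat \<bar>d\<bar>) / (fact j * fact (j + nat \<bar>d\<bar>))) sums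
             (exp (2 * z) * bessel_kernel z (nat \<bar>d\<bar>))"
      using summable_sums[OF summable_bessel[of z "nat \<bar>d\<bar>"]]
      by (simp add: bessel_kernel_def mult.assoc[symmetric] exp_minus)
    hence "((\<lambda>j. z ^ (2 * j + nat \<bar>d\<bar>) / (fact j * fact (j + nat \<bar>d\<bar>))) has_sum
             exp (2 * z) * bessel_kernel z (nat \<bar>d\<bar>)) UNIV"
      using z by (intro sums_nonneg_imp_has_sum) auto
    also have "(\<lambda>j. z ^ (2 * j + nat \<bar>d\<bar>) / (fact j * fact (j + nat \<bar>d\<bar>))) = (\<lambda>j. h (\<phi> (d, j)))"
      by (cases "d \<ge> 0") (auto simp: h_def \<phi>_def power_add mult_2 mult_2_right mult_ac)
    finally show "((\<lambda>j. h (\<phi> (d, j))) has_sum exp (2 * z) * bessel_kernel z (nat \<bar>d\<bar>)) UNIV" .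
  qed
  from has_sum_cmult_right[OF this, of "exp (- 2 * z)"] show ?thesis
    by (simp add: mult.assoc[symmetric] exp_add[symmetric])
qed

text \<open>For \<open>n < k\<close> the first \<open>k - n\<close> terms vanish because the reciprocal Gamma function does, and shifting the
  index past them gives the series of the reflected order: this is \<open>I\<^sub>-\<^sub>d = I\<^sub>d\<close>.\<close>

lemma heat_kernel_eq_bessel_kernel:
  fixes n k :: int
  assumes z: "z > (0::real)"
  shows "exp (- 2 * z) *
        (\<Sum>j. z powi (2 * int j + n - k) * (rGamma (1 + real j) * rGamma (of_int (int j + n - k + 1))))
        = bessel_kernel z (nat \<bar>n - k\<bar>)"
proof -
  define d where "d = nat \<bar>n - k\<bar>"
  define f where "f = (\<lambda>j. z powi (2 * int j + n - k) * (rGamma (1 + real j) * rGamma (real_of_int (int j + n - k + 1))))"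
  have rG: "rGamma (1 + real j) = 1 / fact j" for j
    by (simp add: Gamma_fact[symmetric] rGamma_inverse_Gamma inverse_eq_divide)
  have sums: "(\<lambda>j. z ^ (2 * j + d) / (fact j * fact (j + d))) sums
           (\<Sum>j. z ^ (2 * j + d) / (fact j * fact (j + d)))"
    by (intro summable_sums summable_bessel)
  have "f sums (\<Sum>j. z ^ (2 * j + d) / (fact j * fact (j + d)))"
  proof (cases "n \<ge> k")
    case True
    have "f = (\<lambda>j. z ^ (2 * j + d) / (fact j * fact (j + d)))"
    proof
      fix j
      have "2 * int j + n - k = int (2 * j + d)" "real_of_int (int j + n - k + 1) = 1 + real (j + d)"
        using True by (auto simp: d_def)
      thus "f j = z ^ (2 * j + d) / (fact j * fact (j + d))"
        unfolding f_def by (simp only: rG power_int_of_nat) simp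
    qed
    thus ?thesis using sums by simp
  next
    case False
    have "f j = 0" if "j < d" for j
    proof -
      have "int j + n - k + 1 \<le> 0" using that False by (auto simp: d_def)
      hence "rGamma (real_of_int (int j + n - k + 1)) = 0"
        by (subst rGamma_eq_zero_iff) (rule nonpos_Ints_of_int)
      thus ?thesis by (simp add: f_def)
    qed
    moreover have "f (j + d) = z ^ (2 * j + d) / (fact j * fact (j + d))" for j
    proof -
      have "2 * int (j + d) + n - k = int (2 * j + d)" "real_of_int (int (j + d) + n - k + 1) = 1 + real j"
        using False by (auto simp: d_def)
      thus ?thesis unfolding f_def by (simp only: rG power_int_of_nat) simp
    qed
    ultimately show ?thesis using sums sums_zero_iff_shift[of d f] by simp
  qed
  thus ?thesis by (simp add: bessel_kernel_def f_def d_def sums_iff)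
qed

text \<open>Mass \<open>1\<close> allows \<open>v n\<close> to be moved under the sum. In this form the term \<open>k = n\<close>, whose Mellin integral
  would diverge at \<open>z = 0\<close>, drops out.\<close>

lemma heat_semigroup_minus_id_has_sum:
  assumes z: "z > 0" and bdd: "\<And>k. \<bar>v k\<bar> \<le> B"
  shows "((\<lambda>k. bessel_kernel z (nat \<bar>n - k\<bar>) * (v k - v n)) has_sum (heat_semigroup z v n - v n)) UNIV"
proof -
  have mass: "((\<lambda>k. bessel_kernel z (nat \<bar>n - k\<bar>)) has_sum 1) UNIV"
    using bessel_kernel_has_sum[of z] z by (subst has_sum_reindex_bij_betw[OF bij_int_reflect]) auto
  have nonneg: "bessel_kernel z d \<ge> 0" for d using z by (simp add: bessel_kernel_nonneg)
  have "(\<lambda>k. bessel_kernel z (nat \<bar>n - k\<bar>) * v k) summable_on UNIV"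
  proof (rule abs_summable_summable, rule summable_on_comparison_test)
    show "(\<lambda>k. bessel_kernel z (nat \<bar>n - k\<bar>) * B) summable_on UNIV"
      using has_sum_imp_summable[OF mass] by (rule summable_on_cmult_left)
  qed (use nonneg bdd in \<open>auto simp: abs_mult intro!: mult_left_mono\<close>)
  hence "((\<lambda>k. bessel_kernel z (nat \<bar>n - k\<bar>) * v k) has_sum heat_semigroup z v n) UNIV"
    unfolding heat_semigroup_def heat_kernel_eq_bessel_kernel[OF z] by (rule has_sum_infsum)
  from has_sum_diff[OF this has_sum_cmult_left[OF mass, of "v n"]] show ?thesis
    by (simp add: algebra_simps)
qed

section \<open>The Mellin transform of the heat kernel\<close>

lemma nn_integral_powr_exp_scaled:
  fixes p :: real
  assumes p: "p > 0"
  shows "(\<integral>\<^sup>+z. ennreal (indicator {0<..} z * (z powr (p - 1) * exp (- 2 * z))) \<partial>lborel)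
           = ennreal (2 powr (- p) * Gamma p)"
proof -
  have "ennreal (Gamma p) = (\<integral>\<^sup>+t. ennreal (indicator {0..} t * t powr (p - 1) / exp t) \<partial>lborel)"
    using p by (rule Gamma_conv_nn_integral_real)
  also have "\<dots> = ennreal \<bar>2\<bar> * (\<integral>\<^sup>+z. ennreal (indicator {0..} (0 + 2 * z) * (0 + 2 * z) powr (p - 1) / exp (0 + 2 * z)) \<partial>lborel)"
    by (rule nn_integral_real_affine) auto
  also have "\<dots> = (\<integral>\<^sup>+z. ennreal 2 * ennreal (indicator {0..} (0 + 2 * z) * (0 + 2 * z) powr (p - 1) / exp (0 + 2 * z)) \<partial>lborel)"
    by (subst nn_integral_cmult) auto
  also have "\<dots> = (\<integral>\<^sup>+z. ennreal (2 powr p) * ennreal (indicator {0<..} z * (z powr (p - 1) * exp (- 2 * z))) \<partial>lborel)"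
  proof (intro nn_integral_cong)
    fix z :: real
    have "2 powr p = 2 * 2 powr (p - 1)" by (simp add: powr_diff)
    hence "2 * (indicator {0..} (0 + 2 * z) * (0 + 2 * z) powr (p - 1) / exp (0 + 2 * z)) =
             2 powr p * (indicator {0<..} z * (z powr (p - 1) * exp (- 2 * z)))"
      by (cases "z = 0") (auto simp: indicator_def powr_mult exp_minus field_simps)
    thus "ennreal 2 * ennreal (indicator {0..} (0 + 2 * z) * (0 + 2 * z) powr (p - 1) / exp (0 + 2 * z))
        = ennreal (2 powr p) * ennreal (indicator {0<..} z * (z powr (p - 1) * exp (- 2 * z)))"
      by (simp only: ennreal_mult'[symmetric] zero_le_numeral powr_ge_zero)
  qed
  also have "\<dots> = ennreal (2 powr p) * (\<integral>\<^sup>+z. ennreal (indicator {0<..} z * (z powr (p - 1) * exp (- 2 * z))) \<partial>lborel)"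
    by (subst nn_integral_cmult) auto
  finally have "ennreal (2 powr (- p)) * ennreal (Gamma p) = ennreal (2 powr (- p)) * ennreal (2 powr p) *
      (\<integral>\<^sup>+z. ennreal (indicator {0<..} z * (z powr (p - 1) * exp (- 2 * z))) \<partial>lborel)"
    by (simp add: mult.assoc)
  also have "ennreal (2 powr (- p)) * ennreal (2 powr p) = 1"
    by (subst ennreal_mult'[symmetric]) (auto simp: powr_add[symmetric])
  finally show ?thesis by (simp add: ennreal_mult')
qed

text \<open>Termwise integration of the Bessel series gives Gamma values \<open>\<Gamma>(2j + k - s)\<close>. The duplication
  formula splits each into \<open>\<Gamma>(j + a) \<Gamma>(j + a + 1/2)\<close> with \<open>a = (k - s)/2\<close>, so that Gauss's
  theorem applies with \<open>b = a + 1/2\<close> and \<open>c = k + 1\<close>; its condition \<open>c > a + b\<close> is \<open>s > -1/2\<close>. A second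
  use of the duplication formula simplifies the result.\<close>

lemma bessel_kernel_mellin:
  assumes s: "s > - 1/2" and k: "real k > s"
  shows "(\<integral>\<^sup>+z. ennreal (indicator {0<..} z * (z powr (- s - 1) * bessel_kernel z k)) \<partial>lborel) =
     ennreal (4 powr s * Gamma (1/2 + s) * Gamma (real k - s) / (sqrt pi * Gamma (real k + 1 + s)))"
proof -
  define a where "a = (real k - s) / 2"
  have a: "a > 0" using k by (simp add: a_def)
  define F where "F = (\<lambda>(j::nat) z. 1 / (fact j * fact (j + k)) *
             (indicator {0<..} z * (z powr (2 * (real j + a) - 1) * exp (- 2 * z))))"
  have Gpos: "Gamma x > 0" if "x > 0" for x :: real using that by (rule Gamma_real_pos)
  have F_int: "(\<integral>\<^sup>+z. ennreal (F j z) \<partial>lborel) =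
      ennreal (1 / (2 * sqrt pi) * (Gamma (real j + a) * Gamma (real j + (a + 1/2)) / (fact j * Gamma (real j + (real k + 1)))))" for j
  proof -
    have "(\<integral>\<^sup>+z. ennreal (F j z) \<partial>lborel) = ennreal (1 / (fact j * fact (j + k))) *
       (\<integral>\<^sup>+z. ennreal (indicator {0<..} z * (z powr (2 * (real j + a) - 1) * exp (- 2 * z))) \<partial>lborel)"
      unfolding F_def by (intro nn_integral_ennreal_cmult) auto
    also have "\<dots> = ennreal (1 / (fact j * fact (j + k)) * (2 powr (- (2 * (real j + a))) * Gamma (2 * (real j + a))))"
      using a by (subst nn_integral_powr_exp_scaled) (auto simp: ennreal_mult'[symmetric])
    also have "2 powr (- (2 * (real j + a))) * Gamma (2 * (real j + a)) =
                1 / (2 * sqrt pi) * (Gamma (real j + a) * Gamma (real j + (a + 1/2)))"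
    proof -
      define y where "y = real j + a"
      have "y > 0" using a by (simp add: y_def)
      hence "Gamma y * Gamma (y + 1/2) = 2 * (2 powr (- (2 * y)) * sqrt pi * Gamma (2 * y))"
        using Gamma_legendre_duplication_real[of y] by (simp add: powr_diff powr_minus field_simps)
      thus ?thesis by (simp add: y_def add.assoc)
    qed
    also have "(fact (j + k) :: real) = Gamma (real j + (real k + 1))"
      using Gamma_fact[of "j + k", where 'a = real] by (simp add: add_ac)
    finally show ?thesis by (simp add: field_simps)
  qed
  have F_sum: "(\<Sum>j. ennreal (F j z)) = ennreal (indicator {0<..} z * (z powr (- s - 1) * bessel_kernel z k))" for z
  proof (cases "z > 0")
    case True
    have "(\<lambda>j. z powr (- s - 1) * exp (- 2 * z) * (z ^ (2 * j + k) / (fact j * fact (j + k)))) sums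
            (z powr (- s - 1) * exp (- 2 * z) * (\<Sum>j. z ^ (2 * j + k) / (fact j * fact (j + k))))"
      by (intro sums_mult summable_sums summable_bessel)
    also have "(\<lambda>j. z powr (- s - 1) * exp (- 2 * z) * (z ^ (2 * j + k) / (fact j * fact (j + k)))) = (\<lambda>j. F j z)"
    proof
      fix j
      have "2 * (real j + a) - 1 = real (2 * j + k) + (- s - 1)" by (simp add: a_def field_simps)
      hence "z powr (2 * (real j + a) - 1) = z powr (real (2 * j + k) + (- s - 1))" by (rule arg_cong)
      also have "\<dots> = z ^ (2 * j + k) * z powr (- s - 1)"
        using True by (subst powr_add) (simp only: powr_realpow)
      finally show "z powr (- s - 1) * exp (- 2 * z) * (z ^ (2 * j + k) / (fact j * fact (j + k))) = F j z"
        using True by (simp add: F_def)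
    qed
    finally show ?thesis using True
      by (intro suminf_ennreal_eq) (auto simp: F_def bessel_kernel_def mult_ac)
  qed (simp add: F_def)
  have "(\<lambda>j. 1 / (2 * sqrt pi) * (Gamma (real j + a) * Gamma (real j + (a + 1/2)) / (fact j * Gamma (real j + (real k + 1)))))
      sums (1 / (2 * sqrt pi) * (Gamma a * Gamma (a + 1/2) * Gamma (real k + 1 - a - (a + 1/2)) /
              (Gamma (real k + 1 - a) * Gamma (real k + 1 - (a + 1/2)))))"
    using a s by (intro sums_mult Gauss_hypergeometric_sum) (auto simp: a_def field_simps)
  also have "Gamma a * Gamma (a + 1/2) = 2 powr (1 - 2 * a) * sqrt pi * Gamma (real k - s)"
  proof -
    have "2 * a = real k - s" by (simp add: a_def)
    thus ?thesis using Gamma_legendre_duplication_real[OF a] by simp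
  qed
  also have "Gamma (real k + 1 - a) * Gamma (real k + 1 - (a + 1/2)) =
               2 powr (1 - (real k + 1 + s)) * sqrt pi * Gamma (real k + 1 + s)"
  proof -
    define y where "y = (real k + 1 + s) / 2"
    have y: "y > 0" using s k by (simp add: y_def)
    have "real k + 1 - a = y + 1/2" "real k + 1 - (a + 1/2) = y" "2 * y = real k + 1 + s"
      by (simp_all add: a_def y_def field_simps)
    thus ?thesis using Gamma_legendre_duplication_real[OF y] by (simp only: mult.commute)
  qed
  also have "real k + 1 - a - (a + 1/2) = 1/2 + s" by (simp add: a_def field_simps)
  also have "1 / (2 * sqrt pi) * (2 powr (1 - 2 * a) * sqrt pi * Gamma (real k - s) * Gamma (1/2 + s) /
              (2 powr (1 - (real k + 1 + s)) * sqrt pi * Gamma (real k + 1 + s)))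
      = 4 powr s * Gamma (1/2 + s) * Gamma (real k - s) / (sqrt pi * Gamma (real k + 1 + s))"
  proof -
    define e :: real where "e = 2 powr (1 - (real k + 1 + s))"
    have e: "e \<noteq> 0" by (simp add: e_def)
    have exps: "1 - 2 * a = 1 + 2 * s + (1 - (real k + 1 + s))" by (simp add: a_def field_simps)
    have four: "(4::real) powr s = 2 powr (2 * s)" by (simp add: powr_powr[symmetric])
    have "2 powr (1 - 2 * a) = 2 * 4 powr s * e"
      unfolding exps powr_add four e_def by simp
    moreover have "sqrt pi \<noteq> 0" by simp
    ultimately show ?thesis using e unfolding e_def[symmetric]
      by (simp add: mult_ac)
  qed
  finally have "(\<Sum>j. ennreal (1 / (2 * sqrt pi) * (Gamma (real j + a) * Gamma (real j + (a + 1/2)) / (fact j * Gamma (real j + (real k + 1)))))) =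
     ennreal (4 powr s * Gamma (1/2 + s) * Gamma (real k - s) / (sqrt pi * Gamma (real k + 1 + s)))"
    by (rule suminf_ennreal_eq[rotated])
       (use a in \<open>intro mult_nonneg_nonneg divide_nonneg_nonneg less_imp_le[OF Gpos]; simp\<close>)
  also have "(\<Sum>j. ennreal (1 / (2 * sqrt pi) * (Gamma (real j + a) * Gamma (real j + (a + 1/2)) / (fact j * Gamma (real j + (real k + 1)))))) =
     (\<Sum>j. \<integral>\<^sup>+z. ennreal (F j z) \<partial>lborel)" by (simp only: F_int)
  also have "\<dots> = (\<integral>\<^sup>+z. (\<Sum>j. ennreal (F j z)) \<partial>lborel)"
    by (rule nn_integral_suminf[symmetric]) (auto simp: F_def)
  finally show ?thesis by (simp only: F_sum)
qed

section \<open>The coefficients of the fractional operator\<close>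

text \<open>The Fourier coefficients of \<open>(2 - 2 cos \<theta>)\<^sup>s\<close> at nonnegative frequencies. The formula also gives the mean
  value at \<open>k = 0\<close>, so the recursion in \<open>k\<close> starts there.\<close>

definition frac_coeff :: "real \<Rightarrow> nat \<Rightarrow> real" where
  "frac_coeff s k = 4 powr s * Gamma (1/2 + s) * Gamma (real k - s) /
     (sqrt pi * Gamma (- s) * Gamma (real k + 1 + s))"

lemma frac_coeff_Suc:
  assumes s: "s > 0" "s \<notin> \<int>"
  shows "(real k + 1 + s) * frac_coeff s (Suc k) = (real k - s) * frac_coeff s k"
proof -
  have x: "real k - s \<notin> \<int>\<^sub>\<le>\<^sub>0"
    using nat_diff_not_Ints[OF s(2)] by (meson nonpos_Ints_Int)
  have y: "real k + 1 + s \<notin> \<int>\<^sub>\<le>\<^sub>0" using s by (intro not_nonpos_Ints_if_pos) simp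
  have "Gamma (real (Suc k) - s) = (real k - s) * Gamma (real k - s)"
    using Gamma_plus1[OF x] by (simp add: algebra_simps)
  moreover have "Gamma (real (Suc k) + 1 + s) = (real k + 1 + s) * Gamma (real k + 1 + s)"
    using Gamma_plus1[OF y] by (simp add: algebra_simps)
  ultimately show ?thesis using s by (simp add: frac_coeff_def add_pos_nonneg mult_ac)
qed

text \<open>The Gamma recursion in each of the four Gamma factors makes the quotient \<open>a\<^sub>s\<^sub>+\<^sub>1(k) / a\<^sub>s(k)\<close> rational.
  The recursion in \<open>k\<close> yields the same rational function for the second difference of \<open>a\<^sub>s\<close> over \<open>-a\<^sub>s\<close>.\<close>

lemma frac_coeff_add1:
  assumes s: "s > 0" "s \<notin> \<int>"
  shows "((real k)\<^sup>2 - (s + 1)\<^sup>2) * frac_coeff (s + 1) k = - (2 * (s + 1) * (2 * s + 1)) * frac_coeff s k"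
proof -
  have nonint: "real k - s - 1 \<notin> \<int>"
    using nat_diff_not_Ints[OF not_Ints_add1[OF s(2)], of k] by (simp add: algebra_simps)
  from nonint have "real k - s - 1 \<notin> \<int>\<^sub>\<le>\<^sub>0" by auto
  from Gamma_plus1[OF this] have 1: "Gamma (real k - s) = (real k - s - 1) * Gamma (real k - (s + 1))"
    by (simp add: algebra_simps)
  have nz1: "- (s + 1) \<notin> \<int>\<^sub>\<le>\<^sub>0"
    using not_Ints_add1[OF s(2)] by (metis minus_in_Ints_iff nonpos_Ints_Int)
  have "- (s + 1) + 1 = - s" by simp
  hence 2: "Gamma (- s) = - (s + 1) * Gamma (- (s + 1))"
    using Gamma_plus1[OF nz1] by (simp only:)
  have 3: "Gamma (real k + 1 + (s + 1)) = (real k + 1 + s) * Gamma (real k + 1 + s)"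
    using Gamma_plus1[of "real k + 1 + s"] not_nonpos_Ints_if_pos[of "real k + 1 + s"] s
    by (simp add: algebra_simps)
  have 4: "Gamma (1/2 + (s + 1)) = (1/2 + s) * Gamma (1/2 + s)"
    using Gamma_plus1[of "1/2 + s"] not_nonpos_Ints_if_pos[of "1/2 + s"] s
    by (simp add: algebra_simps)
  have 5: "Gamma (- (s + 1)) \<noteq> 0" using nz1 by (simp add: Gamma_eq_zero_iff)
  have 6: "Gamma (real k + 1 + s) > 0" using s by (intro Gamma_real_pos) simp
  have 7: "(4::real) powr (s + 1) = 4 * 4 powr s" by (simp add: powr_add)
  define X where "X = Gamma (real k - (s + 1))"
  define Y where "Y = Gamma (- (s + 1))"
  define Z where "Z = Gamma (real k + 1 + s)"
  define P where "P = 4 powr s * Gamma (1/2 + s) / sqrt pi"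
  have nz2: "Y \<noteq> 0" "Z \<noteq> 0" "real k + 1 + s \<noteq> 0" "s + 1 \<noteq> 0"
    using 5 less_imp_neq[OF 6] s by (auto simp: Y_def Z_def)
  define W where "W = real k + 1 + s"
  have W: "W \<noteq> 0" using nz2 by (simp add: W_def)
  define q where "q = 1/2 + s"
  have "frac_coeff (s + 1) k = P * (4 * q) * X / (Y * (W * Z))"
    unfolding frac_coeff_def 3 4 7 X_def Y_def Z_def P_def W_def q_def[symmetric] by (simp add: mult_ac)
  also have "4 * q = 4 * s + 2" by (simp add: q_def)
  finally have A: "(real k + 1 + s) * frac_coeff (s + 1) k = (4 * s + 2) * (P * X / (Y * Z))"
    unfolding W_def[symmetric] using nz2 W by simp
  have "frac_coeff s k = P * ((real k - s - 1) * X) / (- (s + 1) * Y * Z)"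
    unfolding frac_coeff_def 1 2 X_def Y_def Z_def P_def by (simp add: field_simps)
  hence B: "(s + 1) * frac_coeff s k = - (real k - s - 1) * (P * X / (Y * Z))"
    using nz2 by (simp add: divide_simps) (simp add: algebra_simps)
  show ?thesis using A B by algebra
qed

text \<open>The multiplier gains a factor \<open>2 - 2 cos \<theta>\<close> when \<open>s\<close> grows by \<open>1\<close>. At \<open>k = 0\<close> the two neighbours
  coincide by evenness.\<close>

lemma frac_coeff_second_difference:
  assumes s: "s > 0" "s \<notin> \<int>"
  shows "frac_coeff (s + 1) (Suc k) = 2 * frac_coeff s (Suc k) - frac_coeff s k - frac_coeff s (Suc (Suc k))"
    and "frac_coeff (s + 1) 0 = 2 * frac_coeff s 0 - 2 * frac_coeff s 1"
proof -
  have sq: "((real j)\<^sup>2 - (s + 1)\<^sup>2) \<noteq> 0" for j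
  proof -
    have "real j - (s + 1) \<noteq> 0" using nat_diff_not_Ints[OF not_Ints_add1[OF s(2)], of j] by (metis Ints_0)
    moreover have "real j + (s + 1) > 0" using s by simp
    ultimately show ?thesis by (simp add: power2_eq_square square_diff_square_factored)
  qed
  have k: "real k - s \<noteq> 0" using s by auto
  have k1: "real k + 1 + s \<noteq> 0" "real k + 2 + s \<noteq> 0" using s by linarith+
  define a where "a = frac_coeff s (Suc k)"
  have a0: "frac_coeff s k = (real k + 1 + s) * a / (real k - s)"
    using frac_coeff_Suc[OF s, of k] k by (simp add: a_def field_simps)
  have a2: "frac_coeff s (Suc (Suc k)) = (real k + 1 - s) * a / (real k + 2 + s)"
    using frac_coeff_Suc[OF s, of "Suc k"] k1 by (simp add: a_def field_simps)
  have "((real (Suc k))\<^sup>2 - (s + 1)\<^sup>2) * (2 * a - frac_coeff s k - frac_coeff s (Suc (Suc k)))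
          = - (2 * (s + 1) * (2 * s + 1)) * a"
    unfolding a0 a2 using k k1 by (simp add: divide_simps) (simp add: algebra_simps power2_eq_square)
  also have "\<dots> = ((real (Suc k))\<^sup>2 - (s + 1)\<^sup>2) * frac_coeff (s + 1) (Suc k)"
    using frac_coeff_add1[OF s, of "Suc k"] by (simp add: a_def)
  finally show "frac_coeff (s + 1) (Suc k) = 2 * frac_coeff s (Suc k) - frac_coeff s k - frac_coeff s (Suc (Suc k))"
    using sq[of "Suc k"] by (simp add: a_def)
  have "(0 - (s + 1)\<^sup>2) * (2 * frac_coeff s 0 - 2 * frac_coeff s 1) = - (2 * (s + 1) * (2 * s + 1)) * frac_coeff s 0"
  proof -
    have "(s + 1) * frac_coeff s 1 = - s * frac_coeff s 0"
      using frac_coeff_Suc[OF s, of 0] by (simp add: algebra_simps)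
    thus ?thesis by algebra
  qed
  also have "\<dots> = (0 - (s + 1)\<^sup>2) * frac_coeff (s + 1) 0"
    using frac_coeff_add1[OF s, of 0] by simp
  finally show "frac_coeff (s + 1) 0 = 2 * frac_coeff s 0 - 2 * frac_coeff s 1"
    using sq[of 0] by (subst (asm) mult_left_cancel) auto
qed

text \<open>With \<open>b\<^sub>k = (k - s) a\<^sub>s(k)\<close> the recursion reads \<open>b\<^sub>k - b\<^sub>k\<^sub>+\<^sub>1 = 2 s a\<^sub>s(k + 1)\<close>. For \<open>k \<ge> s\<close> the
  values \<open>b\<^sub>k\<close>, \<open>b\<^sub>k\<^sub>+\<^sub>1\<close> and \<open>a\<^sub>s(k + 1)\<close> have no opposite signs, so the identity holds for absolute
  values; thus \<open>|b\<^sub>k|\<close> decreases to a limit, which gives absolute summability. As \<open>a\<^sub>s(k)\<close> tends to \<open>0\<close>,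
  the limit of \<open>b\<close> is that of \<open>k a\<^sub>s(k)\<close>, which must be \<open>0\<close> for a summable sequence; telescoping then
  evaluates the sum.\<close>

lemma frac_coeff_sums:
  assumes s: "s > 0" "s \<notin> \<int>"
  shows "summable (\<lambda>k. \<bar>frac_coeff s k\<bar>)"
    and "(\<lambda>k. frac_coeff s (Suc k)) sums (- frac_coeff s 0 / 2)"
proof -
  define b where "b = (\<lambda>k. (real k - s) * frac_coeff s k)"
  have b_diff: "b k - b (Suc k) = 2 * s * frac_coeff s (Suc k)" for k
    using frac_coeff_Suc[OF s, of k] by (simp add: b_def algebra_simps)
  have abs_diff: "\<bar>b k\<bar> - \<bar>b (Suc k)\<bar> = 2 * s * \<bar>frac_coeff s (Suc k)\<bar>" if "real k \<ge> s" for k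
  proof -
    have "b k = (real k + 1 + s) * frac_coeff s (Suc k)"
      using frac_coeff_Suc[OF s, of k] by (simp add: b_def)
    hence "\<bar>b k\<bar> = (real k + 1 + s) * \<bar>frac_coeff s (Suc k)\<bar>" using s by (simp add: abs_mult)
    moreover have "\<bar>b (Suc k)\<bar> = (real k + 1 - s) * \<bar>frac_coeff s (Suc k)\<bar>"
      using that by (simp add: b_def abs_mult)
    ultimately show ?thesis by (simp add: algebra_simps)
  qed
  define N where "N = nat \<lceil>s\<rceil>"
  have N: "real (k + N) \<ge> s" for k unfolding N_def by linarith
  have "decseq (\<lambda>k. \<bar>b (k + N)\<bar>)"
  proof (rule decseq_SucI)
    fix k
    have "0 \<le> 2 * s * \<bar>frac_coeff s (Suc (k + N))\<bar>" using s by simp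
    thus "\<bar>b (Suc k + N)\<bar> \<le> \<bar>b (k + N)\<bar>" using abs_diff[OF N[of k]] by simp
  qed
  then obtain L where L: "(\<lambda>k. \<bar>b (k + N)\<bar>) \<longlonglongrightarrow> L"
    by (rule decseq_convergent[where B = 0]) auto
  have "(\<lambda>k. \<bar>b (k + N)\<bar> - \<bar>b (Suc k + N)\<bar>) sums (\<bar>b (0 + N)\<bar> - L)"
    by (rule telescope_sums'[OF L])
  hence "summable (\<lambda>k. 2 * s * \<bar>frac_coeff s (k + Suc N)\<bar>)"
    using abs_diff[OF N] by (simp add: sums_iff)
  hence "summable (\<lambda>k. \<bar>frac_coeff s (k + Suc N)\<bar>)"
    using s by (subst (asm) summable_cmult_iff) auto
  thus summ: "summable (\<lambda>k. \<bar>frac_coeff s k\<bar>)"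
    by (subst (asm) summable_iff_shift)
  hence summ': "summable (\<lambda>k. frac_coeff s k)" by (rule summable_rabs_cancel)
  hence summ_Suc: "summable (\<lambda>k. frac_coeff s (Suc k))" by (subst summable_Suc_iff)
  have "(\<lambda>k. b 0 - (\<Sum>i<k. 2 * s * frac_coeff s (Suc i))) = b"
  proof
    fix k show "b 0 - (\<Sum>i<k. 2 * s * frac_coeff s (Suc i)) = b k"
      unfolding b_diff[symmetric] by (subst sum_lessThan_telescope') simp
  qed
  moreover have "(\<lambda>k. b 0 - (\<Sum>i<k. 2 * s * frac_coeff s (Suc i))) \<longlonglongrightarrow> b 0 - (\<Sum>i. 2 * s * frac_coeff s (Suc i))"
    by (intro tendsto_intros summable_LIMSEQ summable_mult summ_Suc)
  ultimately have b_lim: "b \<longlonglongrightarrow> b 0 - 2 * s * (\<Sum>i. frac_coeff s (Suc i))" (is "_ \<longlonglongrightarrow> ?L")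
    by (simp add: suminf_mult[OF summ_Suc])
  have "(\<lambda>k. b k + s * frac_coeff s k) \<longlonglongrightarrow> ?L + s * 0"
    by (intro tendsto_intros b_lim summable_LIMSEQ_zero summ')
  hence "(\<lambda>k. real k * frac_coeff s k) \<longlonglongrightarrow> ?L" by (simp add: b_def algebra_simps)
  with not_summable_if_mult_index_tendsto_nonzero summ have "?L = 0" by blast
  hence "(\<Sum>i. frac_coeff s (Suc i)) = - frac_coeff s 0 / 2"
  proof -
    have "s * (2 * (\<Sum>i. frac_coeff s (Suc i)) + frac_coeff s 0) = 0"
      using \<open>?L = 0\<close> by (simp add: b_def algebra_simps)
    hence "2 * (\<Sum>i. frac_coeff s (Suc i)) + frac_coeff s 0 = 0"
      using s by (subst (asm) mult_eq_0_iff) simp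
    thus ?thesis by simp
  qed
  thus "(\<lambda>k. frac_coeff s (Suc k)) sums (- frac_coeff s 0 / 2)"
    using summ_Suc by (simp add: sums_iff)
qed

text \<open>The even extension of the coefficients to the integers.\<close>

definition frac_symbol :: "real \<Rightarrow> int \<Rightarrow> real" where
  "frac_symbol s d = frac_coeff s (nat \<bar>d\<bar>)"

lemma frac_symbol_has_sum:
  assumes s: "s > 0" "s \<notin> \<int>"
  shows "(frac_symbol s has_sum 0) UNIV"
    and "(\<lambda>d. \<bar>frac_symbol s d\<bar>) summable_on UNIV"
proof -
  have "summable (\<lambda>k. \<bar>frac_coeff s (Suc k)\<bar>)"
    using frac_coeff_sums(1)[OF s] by (subst summable_Suc_iff)
  hence "((\<lambda>k. frac_coeff s (Suc k)) has_sum (- frac_coeff s 0 / 2)) UNIV"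
    using frac_coeff_sums(2)[OF s] by (intro norm_summable_imp_has_sum) auto
  from has_sum_int_even[of "frac_coeff s", OF this] show "(frac_symbol s has_sum 0) UNIV"
    by (simp add: frac_symbol_def[abs_def])
  have "((\<lambda>k. \<bar>frac_coeff s (Suc k)\<bar>) has_sum (\<Sum>k. \<bar>frac_coeff s (Suc k)\<bar>)) UNIV"
    using \<open>summable (\<lambda>k. \<bar>frac_coeff s (Suc k)\<bar>)\<close> by (intro sums_nonneg_imp_has_sum summable_sums) auto
  from has_sum_int_even[of "\<lambda>k. \<bar>frac_coeff s k\<bar>", OF this] show "(\<lambda>d. \<bar>frac_symbol s d\<bar>) summable_on UNIV"
    by (simp add: frac_symbol_def[abs_def] has_sum_imp_summable)
qed

lemma frac_symbol_add1:
  assumes s: "s > 0" "s \<notin> \<int>"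
  shows "frac_symbol (s + 1) d = 2 * frac_symbol s d - frac_symbol s (d - 1) - frac_symbol s (d + 1)"
proof (cases d rule: linorder_cases[of _ 0])
  case less
  define k where "k = nat (- d - 1)"
  have "nat \<bar>d\<bar> = Suc k" "nat \<bar>d - 1\<bar> = Suc (Suc k)" "nat \<bar>d + 1\<bar> = k" using less by (auto simp: k_def)
  thus ?thesis using frac_coeff_second_difference(1)[OF s, of k] by (simp add: frac_symbol_def)
next
  case equal
  thus ?thesis using frac_coeff_second_difference(2)[OF s] by (simp add: frac_symbol_def)
next
  case greater
  define k where "k = nat (d - 1)"
  have "nat \<bar>d\<bar> = Suc k" "nat \<bar>d - 1\<bar> = k" "nat \<bar>d + 1\<bar> = Suc (Suc k)" using greater by (auto simp: k_def)
  thus ?thesis using frac_coeff_second_difference(1)[OF s, of k] by (simp add: frac_symbol_def)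
qed

section \<open>Convolution and integer powers of the Laplacian\<close>

definition frac_conv :: "real \<Rightarrow> (int \<Rightarrow> real) \<Rightarrow> int \<Rightarrow> real" where
  "frac_conv s u n = (\<Sum>\<^sub>\<infinity>k. frac_symbol s (n - k) * u k)"

lemma frac_conv_has_sum:
  assumes s: "s > 0" "s \<notin> \<int>" and bdd: "\<And>k. \<bar>u k\<bar> \<le> B"
  shows "((\<lambda>k. frac_symbol s (n - k) * u k) has_sum frac_conv s u n) UNIV"
    and "((\<lambda>k. frac_symbol s (n - k)) has_sum 0) UNIV"
proof -
  show "((\<lambda>k. frac_symbol s (n - k)) has_sum 0) UNIV"
    using frac_symbol_has_sum(1)[OF s] by (subst has_sum_reindex_bij_betw[OF bij_int_reflect])
  have "(\<lambda>k. \<bar>frac_symbol s (n - k)\<bar>) summable_on UNIV"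
    using frac_symbol_has_sum(2)[OF s]
    by (subst summable_on_reindex_bij_betw[OF bij_int_reflect])
  hence "(\<lambda>k. \<bar>frac_symbol s (n - k)\<bar> * B) summable_on UNIV"
    by (rule summable_on_cmult_left)
  hence "(\<lambda>k. norm (frac_symbol s (n - k) * u k)) summable_on UNIV"
    by (rule summable_on_comparison_test) (use bdd in \<open>auto simp: abs_mult intro!: mult_left_mono\<close>)
  hence "(\<lambda>k. frac_symbol s (n - k) * u k) summable_on UNIV"
    by (rule abs_summable_summable)
  thus "((\<lambda>k. frac_symbol s (n - k) * u k) has_sum frac_conv s u n) UNIV"
    unfolding frac_conv_def by (rule has_sum_infsum)
qed

text \<open>Summation by parts: the Laplacian moves from the sequence to the coefficients.\<close>

lemma frac_conv_neg_laplace: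
  assumes s: "s > 0" "s \<notin> \<int>" and bdd: "\<And>k. \<bar>u k\<bar> \<le> B"
  shows "frac_conv (s + 1) u n = frac_conv s (\<lambda>k. - discrete_laplace u k) n"
proof -
  note sum = frac_conv_has_sum(1)[OF s bdd]
  have shift: "((\<lambda>k. frac_symbol s (n - k) * u (k + c)) has_sum frac_conv s u (n + c)) UNIV" for c
    using has_sum_reindex_bij_betw[OF bij_int_translate[of c], of "\<lambda>k. frac_symbol s (n + c - k) * u k"]
          sum[of "n + c"] by simp
  have "((\<lambda>k. 2 * (frac_symbol s (n - k) * u k) - frac_symbol s (n + - 1 - k) * u k - frac_symbol s (n + 1 - k) * u k)
      has_sum 2 * frac_conv s u n - frac_conv s u (n + - 1) - frac_conv s u (n + 1)) UNIV"
    by (intro has_sum_diff has_sum_cmult_right sum)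
  also have "(\<lambda>k. 2 * (frac_symbol s (n - k) * u k) - frac_symbol s (n + - 1 - k) * u k - frac_symbol s (n + 1 - k) * u k)
       = (\<lambda>k. frac_symbol (s + 1) (n - k) * u k)"
  proof
    fix k
    have "n + - 1 - k = n - k - 1" "n + 1 - k = n - k + 1" by simp_all
    thus "2 * (frac_symbol s (n - k) * u k) - frac_symbol s (n + - 1 - k) * u k - frac_symbol s (n + 1 - k) * u k
            = frac_symbol (s + 1) (n - k) * u k"
      by (simp only: frac_symbol_add1[OF s, of "n - k"]) (simp add: algebra_simps)
  qed
  finally have lhs: "frac_conv (s + 1) u n = 2 * frac_conv s u n - frac_conv s u (n + - 1) - frac_conv s u (n + 1)"
    unfolding frac_conv_def[of "s + 1"] by (rule infsumI)
  have "((\<lambda>k. 2 * (frac_symbol s (n - k) * u k) - frac_symbol s (n - k) * u (k + - 1) - frac_symbol s (n - k) * u (k + 1))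
      has_sum 2 * frac_conv s u n - frac_conv s u (n + - 1) - frac_conv s u (n + 1)) UNIV"
    by (intro has_sum_diff has_sum_cmult_right sum shift)
  also have "(\<lambda>k. 2 * (frac_symbol s (n - k) * u k) - frac_symbol s (n - k) * u (k + - 1) - frac_symbol s (n - k) * u (k + 1))
      = (\<lambda>k. frac_symbol s (n - k) * (- discrete_laplace u k))"
    by (simp add: discrete_laplace_def algebra_simps)
  finally have "frac_conv s (\<lambda>k. - discrete_laplace u k) n = 2 * frac_conv s u n - frac_conv s u (n + - 1) - frac_conv s u (n + 1)"
    unfolding frac_conv_def[of s "\<lambda>k. - discrete_laplace u k"] by (rule infsumI)
  with lhs show ?thesis by simp
qed

lemma bounded_neg_laplace:
  assumes "\<And>k. \<bar>u k\<bar> \<le> B"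
  shows "\<bar>- discrete_laplace u k\<bar> \<le> 4 * B"
  using assms[of "k - 1"] assms[of k] assms[of "k + 1"] unfolding discrete_laplace_def by linarith

lemma bounded_neg_laplace_power:
  assumes "\<And>k. \<bar>u k\<bar> \<le> B"
  shows "\<bar>neg_laplace_power p u k\<bar> \<le> 4 ^ p * B"
proof (induction p arbitrary: k)
  case (Suc p)
  from bounded_neg_laplace[of "neg_laplace_power p u", OF Suc] show ?case
    by (simp add: neg_laplace_power_def mult.assoc)
qed (use assms in \<open>simp add: neg_laplace_power_def\<close>)

lemma frac_conv_neg_laplace_power:
  assumes s: "s > 0" "s \<notin> \<int>" and bdd: "\<And>k. \<bar>u k\<bar> \<le> B"
  shows "frac_conv (s + real p) u n = frac_conv s (neg_laplace_power p u) n"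
  using bdd
proof (induction p arbitrary: u B)
  case (Suc p)
  have nonint: "s + real p \<notin> \<int>" using Ints_diff[of "s + real p" "real p"] s by auto
  have "frac_conv (s + real (Suc p)) u n = frac_conv (s + real p + 1) u n" by (simp add: add_ac)
  also have "\<dots> = frac_conv (s + real p) (\<lambda>k. - discrete_laplace u k) n"
    using s nonint by (intro frac_conv_neg_laplace[OF _ _ Suc.prems]) auto
  also have "\<dots> = frac_conv s (neg_laplace_power p (\<lambda>k. - discrete_laplace u k)) n"
    by (rule Suc.IH) (rule bounded_neg_laplace[OF Suc.prems])
  also have "neg_laplace_power p (\<lambda>k. - discrete_laplace u k) = neg_laplace_power (Suc p) u"
    unfolding neg_laplace_power_def funpow_Suc_right by simp
  finally show ?case .
qed (simp add: neg_laplace_power_def)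

section \<open>Integrating the heat semigroup\<close>

text \<open>The passage from the extended nonnegative integral to the Bochner integral, which supplies
  integrability.\<close>

lemma bessel_kernel_integral:
  assumes s: "s > 0" "s \<notin> \<int>" and k: "real k > s"
  shows "integrable lborel (\<lambda>z. indicator {0<..} z * (z powr (- s - 1) * bessel_kernel z k))"
    and "(LINT z|lborel. indicator {0<..} z * (z powr (- s - 1) * bessel_kernel z k)) = Gamma (- s) * frac_coeff s k"
proof -
  let ?f = "\<lambda>z. indicator {0<..} z * (z powr (- s - 1) * bessel_kernel z k)"
  define M where "M = 4 powr s * Gamma (1/2 + s) * Gamma (real k - s) / (sqrt pi * Gamma (real k + 1 + s))"
  have Gpos: "Gamma x > 0" if "x > 0" for x :: real using that by (rule Gamma_real_pos)
  have M: "M \<ge> 0" unfolding M_def using s k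
    by (intro divide_nonneg_nonneg mult_nonneg_nonneg less_imp_le[OF Gpos]) auto
  have nonneg: "?f z \<ge> 0" for z by (auto simp: indicator_def bessel_kernel_nonneg)
  have nn: "(\<integral>\<^sup>+z. ennreal (?f z) \<partial>lborel) = ennreal M"
    unfolding M_def using s k by (intro bessel_kernel_mellin) auto
  have "Gamma (- s) \<noteq> 0" using s(2) by (rule Gamma_uminus_neq_0)
  hence M_eq: "M = Gamma (- s) * frac_coeff s k" by (simp add: M_def frac_coeff_def)
  have meas: "?f \<in> borel_measurable lborel" by measurable
  show "integrable lborel ?f"
    by (rule integrableI_nn_integral_finite[OF meas _ nn]) (use nonneg M in auto)
  show "(LINT z|lborel. ?f z) = Gamma (- s) * frac_coeff s k"
    using M nonneg meas nn unfolding M_eq[symmetric] by (subst integral_eq_nn_integral) auto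
qed

text \<open>The integral of \<open>S\<^sub>z v - v\<close> is computed term by term in \<open>k\<close>. Since the kernel is nonnegative, the
  integral of the absolute value of each term is the absolute value of its integral,
  so dominated convergence only needs the absolute summability of the coefficients.\<close>

lemma heat_semigroup_integral:
  assumes \<alpha>: "0 < \<alpha>" "\<alpha> < 1" and bdd: "\<And>k. \<bar>v k\<bar> \<le> B"
  shows "(LBINT z:{0<..}. z powr (- \<alpha> - 1) * (heat_semigroup z v n - v n))
           = Gamma (- \<alpha>) * frac_conv \<alpha> v n"
proof -
  have nonint: "\<alpha> \<notin> \<int>" using \<alpha> by (auto elim!: Ints_cases)
  \<comment> \<open>The theorem on integrating series is about sequences, so the integers are enumerated.\<close>
  define \<kappa> where "\<kappa> = int_decode"
  have bij: "bij_betw \<kappa> UNIV UNIV"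
    unfolding \<kappa>_def by (rule bij_int_decode)
  define f where "f = (\<lambda>i z. indicator {0<..} z * (z powr (- \<alpha> - 1) * bessel_kernel z (nat \<bar>n - \<kappa> i\<bar>)) * (v (\<kappa> i) - v n))"
  define c where "c = (\<lambda>k. frac_symbol \<alpha> (n - k) * (v k - v n))"
  have f_int: "integrable lborel (f i)" and f_val: "(LINT z|lborel. f i z) = Gamma (- \<alpha>) * c (\<kappa> i)"
    and f_abs: "(LINT z|lborel. norm (f i z)) = \<bar>Gamma (- \<alpha>) * c (\<kappa> i)\<bar>" for i
  proof -
    have "integrable lborel (f i) \<and> (LINT z|lborel. f i z) = Gamma (- \<alpha>) * c (\<kappa> i) \<and>
          (LINT z|lborel. norm (f i z)) = \<bar>Gamma (- \<alpha>) * c (\<kappa> i)\<bar>"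
    proof (cases "\<kappa> i = n")
      case True
      thus ?thesis by (simp add: f_def c_def)
    next
      case False
      hence "real (nat \<bar>n - \<kappa> i\<bar>) > \<alpha>" using \<alpha>(2) by linarith
      note int = bessel_kernel_integral[OF \<alpha>(1) nonint this]
      let ?g = "\<lambda>z. indicator {0<..} z * (z powr (- \<alpha> - 1) * bessel_kernel z (nat \<bar>n - \<kappa> i\<bar>))"
      have g_nonneg: "?g z \<ge> 0" for z by (auto simp: indicator_def bessel_kernel_nonneg)
      define J where "J = Gamma (- \<alpha>) * frac_symbol \<alpha> (n - \<kappa> i)"
      have J: "(LINT z|lborel. ?g z) = J" using int(2) by (simp add: J_def frac_symbol_def)
      have "(LINT z|lborel. ?g z) \<ge> 0" using g_nonneg by (intro integral_nonneg_AE) auto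
      hence J_abs: "\<bar>J * x\<bar> = J * \<bar>x\<bar>" for x unfolding J by (simp add: abs_mult)
      have c_J: "Gamma (- \<alpha>) * c (\<kappa> i) = J * (v (\<kappa> i) - v n)" by (simp add: J_def c_def)
      have f_g: "f i = (\<lambda>z. ?g z * (v (\<kappa> i) - v n))" by (simp add: f_def)
      have norm_f: "(\<lambda>z. norm (f i z)) = (\<lambda>z. ?g z * \<bar>v (\<kappa> i) - v n\<bar>)"
        unfolding f_g norm_mult[of "?g _"] using g_nonneg by (simp only: real_norm_def abs_of_nonneg)
      have "(LINT z|lborel. norm (f i z)) = J * \<bar>v (\<kappa> i) - v n\<bar>"
        unfolding norm_f integral_mult_left_zero J ..
      moreover have "(LINT z|lborel. f i z) = J * (v (\<kappa> i) - v n)"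
        unfolding f_g integral_mult_left_zero J ..
      moreover have "integrable lborel (f i)" unfolding f_g using int(1) by simp
      ultimately show ?thesis unfolding c_J J_abs by (intro conjI)
    qed
    thus "integrable lborel (f i)" "(LINT z|lborel. f i z) = Gamma (- \<alpha>) * c (\<kappa> i)"
      "(LINT z|lborel. norm (f i z)) = \<bar>Gamma (- \<alpha>) * c (\<kappa> i)\<bar>" by blast+
  qed
  have f_sums: "(\<lambda>i. f i z) sums (indicator {0<..} z * (z powr (- \<alpha> - 1) * (heat_semigroup z v n - v n)))"
    and f_summ: "summable (\<lambda>i. norm (f i z))" for z
  proof -
    have "(\<lambda>i. f i z) sums (indicator {0<..} z * (z powr (- \<alpha> - 1) * (heat_semigroup z v n - v n))) \<and>
      summable (\<lambda>i. norm (f i z))"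
    proof (cases "z > 0")
      case True
      have "((\<lambda>k. z powr (- \<alpha> - 1) * (bessel_kernel z (nat \<bar>n - k\<bar>) * (v k - v n))) has_sum
              z powr (- \<alpha> - 1) * (heat_semigroup z v n - v n)) UNIV"
        by (intro has_sum_cmult_right heat_semigroup_minus_id_has_sum[OF True bdd])
      hence *: "((\<lambda>i. f i z) has_sum z powr (- \<alpha> - 1) * (heat_semigroup z v n - v n)) UNIV"
        using True by (subst (asm) has_sum_reindex_bij_betw[OF bij, symmetric]) (simp add: f_def mult_ac)
      have "summable (\<lambda>i. norm (f i z))"
        using summable_on_imp_summable[OF has_sum_imp_abs_summable_real[OF *]] by simp
      thus ?thesis using has_sum_imp_sums[OF *] True by simp
    qed (simp add: f_def)
    thus "(\<lambda>i. f i z) sums (indicator {0<..} z * (z powr (- \<alpha> - 1) * (heat_semigroup z v n - v n)))"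
      "summable (\<lambda>i. norm (f i z))" by blast+
  qed
  have "((\<lambda>k. frac_symbol \<alpha> (n - k) * v k - frac_symbol \<alpha> (n - k) * v n) has_sum (frac_conv \<alpha> v n - 0 * v n)) UNIV"
    using frac_conv_has_sum[OF \<alpha>(1) nonint bdd, of n]
    by (intro has_sum_diff has_sum_cmult_left)
  hence "(c has_sum frac_conv \<alpha> v n) UNIV" by (simp add: c_def[abs_def] algebra_simps)
  hence "(c \<circ> \<kappa> has_sum frac_conv \<alpha> v n) UNIV"
    by (simp add: o_def has_sum_reindex_bij_betw[OF bij])
  hence *: "((\<lambda>i. Gamma (- \<alpha>) * c (\<kappa> i)) has_sum Gamma (- \<alpha>) * frac_conv \<alpha> v n) UNIV"
    unfolding o_def by (rule has_sum_cmult_right)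
  have c_sums: "(\<lambda>i. Gamma (- \<alpha>) * c (\<kappa> i)) sums (Gamma (- \<alpha>) * frac_conv \<alpha> v n)"
    using * by (rule has_sum_imp_sums)
  have c_summ: "summable (\<lambda>i. \<bar>Gamma (- \<alpha>) * c (\<kappa> i)\<bar>)"
    by (rule summable_on_imp_summable[OF has_sum_imp_abs_summable_real[OF *]])
  have "(LBINT z:{0<..}. z powr (- \<alpha> - 1) * (heat_semigroup z v n - v n)) = (LINT z|lborel. (\<Sum>i. f i z))"
    unfolding set_lebesgue_integral_def real_scaleR_def sums_unique[OF f_sums, symmetric] ..
  also have "\<dots> = (\<Sum>i. LINT z|lborel. f i z)"
    by (rule integral_suminf) (simp_all only: f_int f_summ f_abs c_summ always_eventually simp_thms)
  also have "\<dots> = Gamma (- \<alpha>) * frac_conv \<alpha> v n"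
    unfolding f_val using c_sums by (rule sums_unique[symmetric])
  finally show ?thesis .
qed

section \<open>The fractional Laplacian as a sum of differences\<close>

lemma ell2_bounded:
  assumes "u \<in> ell2"
  obtains B where "\<And>k. \<bar>u k\<bar> \<le> B"
proof
  fix k
  have "(\<Sum>i\<in>{k}. \<bar>u i\<bar>\<^sup>2) \<le> (\<Sum>\<^sub>\<infinity>i. \<bar>u i\<bar>\<^sup>2)"
    using assms by (intro finite_sum_le_infsum) (auto simp: ell2_def)
  thus "\<bar>u k\<bar> \<le> sqrt (\<Sum>\<^sub>\<infinity>i. \<bar>u i\<bar>\<^sup>2)" by (simp add: real_le_rsqrt)
qed

lemma frac_kernel_eq_neg_frac_symbol:
  "frac_kernel s d = (if d = 0 then 0 else - frac_symbol s d)"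
  by (simp add: frac_kernel_def frac_symbol_def frac_coeff_def)

theorem lemma6p1:
  fixes m :: nat and s :: real and u :: "int \<Rightarrow> real" and n :: int
  assumes "m \<ge> 1"
    and "s \<in> {real m - 1<..<real m}"
    and "u \<in> ell2"
  shows "((\<lambda>k. frac_kernel s (n - k) * (u n - u k)) has_sum frac_laplace s u n) UNIV"
proof -
  define p where "p = m - 1"
  have m: "real m = real p + 1" using assms(1) by (simp add: p_def)
  have s: "real p < s" "s < real p + 1" using assms(2) m by auto
  hence floor: "\<lfloor>s\<rfloor> = int p" by (intro floor_unique) auto
  define \<alpha> where "\<alpha> = s - real p"
  have \<alpha>: "0 < \<alpha>" "\<alpha> < 1" and s_eq: "s = \<alpha> + real p" using s by (auto simp: \<alpha>_def)
  have \<alpha>_int: "\<alpha> \<notin> \<int>" using \<alpha> by (auto elim!: Ints_cases)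
  have s_pos: "s > 0" and s_int: "s \<notin> \<int>"
    using \<alpha> \<alpha>_int Ints_diff[of s "real p"] by (auto simp: s_eq)
  obtain B where B: "\<And>k. \<bar>u k\<bar> \<le> B" using ell2_bounded[OF assms(3)] by blast
  have G: "Gamma (- \<alpha>) \<noteq> 0" using \<alpha>_int by (rule Gamma_uminus_neq_0)
  have "frac_laplace s u n = 1 / Gamma (- \<alpha>) *
     (LBINT z:{0<..}. z powr (- \<alpha> - 1) * (heat_semigroup z (neg_laplace_power p u) n - neg_laplace_power p u n))"
    by (simp add: frac_laplace_def floor \<alpha>_def)
  also have "\<dots> = frac_conv \<alpha> (neg_laplace_power p u) n"
    using G heat_semigroup_integral[OF \<alpha>, of "neg_laplace_power p u" "4 ^ p * B" n]
          bounded_neg_laplace_power[OF B] by simp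
  also have "\<dots> = frac_conv s u n"
    unfolding s_eq using frac_conv_neg_laplace_power[OF \<alpha>(1) \<alpha>_int B] by simp
  finally have eq: "frac_laplace s u n = frac_conv s u n" .
  \<comment> \<open>The coefficients sum to \<open>0\<close>, so subtracting \<open>u n\<close> from every value leaves the convolution unchanged.\<close>
  have "((\<lambda>k. frac_symbol s (n - k) * u k - frac_symbol s (n - k) * u n) has_sum (frac_conv s u n - 0 * u n)) UNIV"
    using frac_conv_has_sum[OF s_pos s_int B, of n] by (intro has_sum_diff has_sum_cmult_left)
  also have "(\<lambda>k. frac_symbol s (n - k) * u k - frac_symbol s (n - k) * u n)
              = (\<lambda>k. frac_kernel s (n - k) * (u n - u k))"
    by (auto simp: frac_kernel_eq_neg_frac_symbol algebra_simps)
  finally show ?thesis by (simp add: eq)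
qed

end
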